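(* Let $s\in(0,1)$, let $\Omega\subseteq\mathbb{R}^n$ be an open bounded Lipschitz domain, let $H\in L^1(\Omega)$, and let $M\subseteq\mathbb{R}^n$ be a set with $\operatorname{Per}_s(M,\Omega)<+\infty$. Let $$\mathscr{F}:=\big\{F\subseteq\mathbb{R}^n:\ \operatorname{Per}_s(F,\Omega)<+\infty\ \text{and}\ F\setminus\Omega=M\setminus\Omega\big\}.$$ Then $\mathscr{F}$ admits an element of variational non-local mean curvature $H$, i.e. there exists $E\in\mathscr{F}$ such that $$\mathscr{J}^H_{\Omega,s}(E)=\inf\big\{\mathscr{J}^H_{\Omega,s}(F):\ F\in\mathscr{F}\big\}.$$
   Context: All sets are Lebesgue measurable. For disjoint $A,B\subseteq\mathbb{R}^n$, $\mathcal{L}(A,B):=\int_A\int_B\frac{dx\,dy}{|x-y|^{n+s}}$; $\operatorname{Per}_s(E,\Omega):=\mathcal{L}(E\cap\Omega,E^c)+\mathcal{L}(E\cap\Omega^c,E^c\cap\Omega)$. The non-local Massari functional is $\mathscr{J}^H_{\Omega,s}(F):=\operatorname{Per}_s(F,\Omega)+\int_{F\cap\Omega}H(x)\,dx$. *)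

theory Defs
  imports "HOL-Analysis.Analysis"
begin

definition frac_interaction :: "real \<Rightarrow> (real ^ 'n) set \<Rightarrow> (real ^ 'n) set \<Rightarrow> ennreal" where
  "frac_interaction s A B =
     (\<integral>\<^sup>+x\<in>A. (\<integral>\<^sup>+y\<in>B. ennreal (1 / norm (x - y) powr (real CARD('n) + s)) \<partial>lebesgue) \<partial>lebesgue)"

definition frac_perimeter :: "real \<Rightarrow> (real ^ 'n) set \<Rightarrow> (real ^ 'n) set \<Rightarrow> ennreal" where
  "frac_perimeter s E \<Omega> =
     frac_interaction s (E \<inter> \<Omega>) (- E) + frac_interaction s (E \<inter> - \<Omega>) (- E \<inter> \<Omega>)"

(* Extended-real valued, since the perimeter may be infinite; H is used on \<Omega> only. *)
definition massari :: "real \<Rightarrow> (real ^ 'n \<Rightarrow> real) \<Rightarrow> (real ^ 'n) set \<Rightarrow> (real ^ 'n) set \<Rightarrow> ereal" where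
  "massari s H \<Omega> F =
     enn2ereal (frac_perimeter s F \<Omega>) + ereal (LINT x:F \<inter> \<Omega>|lebesgue. H x)"

(* Near each boundary point, after a rotation sending \<nu> to the last coordinate vector, \<Omega> is the
   region strictly above the graph of a Lipschitz function \<gamma> of the other n - 1 coordinates
   (x - (x \<bullet> \<nu>) \<nu> is the projection of x to the hyperplane orthogonal to \<nu>).
   Connectedness of \<Omega> is not required. *)
definition lipschitz_domain :: "(real ^ 'n) set \<Rightarrow> bool" where
  "lipschitz_domain \<Omega> \<longleftrightarrow>
     open \<Omega> \<and>
     (\<forall>p\<in>frontier \<Omega>. \<exists>U \<nu> \<gamma> C.
        open U \<and> p \<in> U \<and> norm \<nu> = 1 \<and> C-lipschitz_on {z. z \<bullet> \<nu> = 0} \<gamma> \<and>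
        \<Omega> \<inter> U = {x \<in> U. x \<bullet> \<nu> > (\<gamma> (x - (x \<bullet> \<nu>) *\<^sub>R \<nu>) :: real)})"

definition competitors :: "real \<Rightarrow> (real ^ 'n) set \<Rightarrow> (real ^ 'n) set \<Rightarrow> (real ^ 'n) set set" where
  "competitors s \<Omega> M =
     {F \<in> sets lebesgue. frac_perimeter s F \<Omega> < \<infinity> \<and> F - \<Omega> = M - \<Omega>}"

end

theory Submission
  imports Defs
begin

text \<open>
  Sets are relaxed to functions \<open>u\<close> with values in \<open>[0, 1]\<close>. With \<open>h = H\<close> on \<open>\<Omega>\<close> and \<open>h = 0\<close> outside, and up to the
  constant \<open>\<integral> h\<^sup>-\<close>, the Massari functional of \<open>F\<close> is the value at the indicator function of \<open>F\<close> of the convex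
  energy \<open>\<integral>\<integral> k(x, y) (u(x) - u(y))\<^sup>+ + \<integral> (h\<^sup>+ u + h\<^sup>- (1 - u))\<close>. Almost minimal elements of \<open>L\<^sup>2(\<Omega>)\<close>-norm
  among the functions of almost minimal energy form a Cauchy sequence by the parallelogram law; a
  subsequence converges almost everywhere, and by Fatou the limit has at most the energy of every
  competitor. By the coarea formula the mean over \<open>t \<in> (0, 1)\<close> of the energies of the superlevel
  sets \<open>{u > t}\<close> is at most the energy of \<open>u\<close>, so one of them is a minimizer. Convexity thus replaces the compact embedding
  of the fractional Sobolev space.
\<close>

section \<open>Almost everywhere convergent selections from decreasing midpoint-convex sets\<close>

text \<open>The infima \<open>D n\<close> of the squared L2 norm over \<open>C n\<close> increase
  and are bounded by the total mass, so they converge. By the parallelogram law, near-minimizers are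
  then L2-Cauchy, and a sufficiently fast subsequence converges almost everywhere.\<close>

lemma (in finite_measure) midpoint_convex_AE_convergent:
  fixes C :: "nat \<Rightarrow> ('a \<Rightarrow> real) set"
  assumes meas: "\<And>n u. u \<in> C n \<Longrightarrow> u \<in> borel_measurable M"
    and bound: "\<And>n u x. u \<in> C n \<Longrightarrow> \<bar>u x\<bar> \<le> 1"
    and nonempty: "\<And>n. C n \<noteq> {}"
    and decseq: "decseq C"
    and midpoint: "\<And>n u v. u \<in> C n \<Longrightarrow> v \<in> C n \<Longrightarrow> (\<lambda>x. (u x + v x) / 2) \<in> C n"
  obtains g where "\<And>n. g n \<in> C n" "AE x in M. convergent (\<lambda>n. g n x)"
proof -
  define q where "q u = (\<integral>x. (u x)\<^sup>2 \<partial>M)" for u :: "'a \<Rightarrow> real"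
  define D where "D n = (INF u\<in>C n. q u)" for n
  have int: "integrable M (\<lambda>x. u x * v x)" if "u \<in> C n" "v \<in> C m" for u v n m
  proof (rule integrable_const_bound[of _ 1])
    show "AE x in M. norm (u x * v x) \<le> 1"
      using bound[OF that(1)] bound[OF that(2)] by (auto simp: abs_mult intro!: mult_le_one)
    show "(\<lambda>x. u x * v x) \<in> borel_measurable M"
      using meas that by (intro borel_measurable_times) auto
  qed
  have q_nonneg: "0 \<le> q u" for u
    unfolding q_def by simp
  have bdd: "bdd_below (q ` C n)" for n
    using q_nonneg by (intro bdd_belowI2[of _ 0])
  have D_le: "D n \<le> q u" if "u \<in> C n" for n u
    unfolding D_def using that bdd by (rule cINF_lower[rotated])
  have q_le: "q u \<le> measure M (space M)" if "u \<in> C n" for u n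
  proof -
    have "q u \<le> (\<integral>x. 1 \<partial>M)"
      unfolding q_def
    proof (rule integral_mono)
      show "integrable M (\<lambda>x. (u x)\<^sup>2)"
        using int[OF that that] by (simp add: power2_eq_square)
      show "(u x)\<^sup>2 \<le> 1" for x
        using bound[OF that, of x] by (simp add: abs_square_le_1)
    qed simp
    then show ?thesis by simp
  qed
  have C_mono: "C m \<subseteq> C n" if "n \<le> m" for n m
    using decseq that by (simp add: decseq_def)
  have "incseq D"
    unfolding incseq_def D_def using nonempty bdd C_mono by (intro allI impI cINF_superset_mono) (auto dest: C_mono)
  moreover have "D n \<le> measure M (space M)" for n
    using nonempty[of n] D_le q_le by (meson ex_in_conv order_trans)
  ultimately obtain L where L: "D \<longlonglongrightarrow> L" "\<And>n. D n \<le> L"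
    using incseq_convergent by blast
  define e :: "nat \<Rightarrow> real" where "e n = (1/2)^n" for n
  have "\<exists>u\<in>C n. q u < D n + e n" for n
    using cINF_less_iff[OF nonempty bdd, of n "D n + e n"] by (simp add: D_def e_def)
  then obtain u where u: "\<And>n. u n \<in> C n" "\<And>n. q (u n) < D n + e n"
    by metis
  \<comment> \<open>A bound uniform in m: the parallelogram law gives 2 (D m - D k) + 2 (e k + e m),
    where D m \<le> L and e m \<le> e k.\<close>
  define \<eta> where "\<eta> n = 4 * (L - D n) + 4 * e n" for n
  have close: "q (\<lambda>x. u k x - u m x) \<le> \<eta> k" if "k \<le> m" for k m
  proof -
    \<comment> \<open>Both functions lie in the larger set \<open>C k\<close>, so their midpoint
      does too and its squared norm is at least \<open>D k\<close>.\<close>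
    have um: "u m \<in> C k"
      using u(1) C_mono[OF that] by blast
    define Q where "Q = q (\<lambda>x. (u k x + u m x) / 2)"
    have 1: "D k \<le> Q"
      unfolding Q_def by (intro D_le midpoint u um)
    have "q (\<lambda>x. u k x - u m x)
        = (\<integral>x. 2 * (u k x * u k x) + 2 * (u m x * u m x)
            - 4 * (((u k x + u m x) / 2) * ((u k x + u m x) / 2)) \<partial>M)"
      unfolding q_def by (intro Bochner_Integration.integral_cong) (auto simp: power2_eq_square field_simps)
    also have "\<dots> = 2 * q (u k) + 2 * q (u m) - 4 * Q"
      unfolding Q_def q_def power2_eq_square
      using int[OF u(1) u(1)] int[OF midpoint[OF u(1) um] midpoint[OF u(1) um]]
      by (simp del: times_divide_eq_left times_divide_eq_right)
    also have "\<dots> \<le> 2 * (D k + e k) + 2 * (D m + e m) - 4 * D k"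
      using u(2)[of k] u(2)[of m] 1 by argo
    also have "\<dots> = 2 * (D m - D k) + 2 * (e k + e m)"
      by simp
    also have "\<dots> \<le> \<eta> k"
    proof -
      have "e m \<le> e k"
        unfolding e_def using that by (intro power_decreasing) auto
      then show ?thesis
        using L(2)[of m] L(2)[of k] unfolding \<eta>_def by argo
    qed
    finally show ?thesis .
  qed
  have "\<eta> \<longlonglongrightarrow> 4 * (L - L) + 4 * 0"
    unfolding \<eta>_def e_def by (intro tendsto_intros L) auto
  then have "\<eta> \<longlonglongrightarrow> 0" by simp
  \<comment> \<open>The rate 1/4 leaves a summable (1/2)^j after the weighting by 2^j below.\<close>
  then have "\<exists>N. \<forall>k\<ge>N. \<eta> k < (1/4)^j" for j
    unfolding eventually_sequentially[symmetric] by (rule order_tendstoD) auto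
  then obtain N where N: "\<And>j k. N j \<le> k \<Longrightarrow> \<eta> k < (1/4)^j"
    by metis
  \<comment> \<open>Summing the thresholds makes \<open>r\<close> increasing, so
    \<open>close\<close> applies to consecutive indices; the summand j ensures r j \<ge> j, hence
    \<open>u (r j) \<in> C j\<close>.\<close>
  define r where "r j = j + (\<Sum>i\<le>j. N i)" for j
  have r_ge: "N j \<le> r j" "j \<le> r j" for j
    unfolding r_def using member_le_sum[of j "{..j}" N] by auto
  define d where "d j x = u (r j) x - u (r (Suc j)) x" for j x
  have [measurable]: "u n \<in> borel_measurable M" for n
    using meas u(1) by blast
  have [measurable]: "d j \<in> borel_measurable M" for j
    unfolding d_def by measurable
  have qd: "q (d j) \<le> (1/4)^j" for j
    using close[of "r j" "r (Suc j)"] N[OF r_ge(1), of j] by (simp add: d_def[abs_def] r_def)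
  have d_int: "integrable M (\<lambda>x. (d j x)\<^sup>2)" for j
  proof (rule integrable_const_bound[of _ 4])
    show "AE x in M. norm ((d j x)\<^sup>2) \<le> 4"
    proof (rule AE_I2)
      fix x
      have "\<bar>d j x\<bar> \<le> 2"
        using bound[OF u(1), of "r j" x] bound[OF u(1), of "r (Suc j)" x] unfolding d_def by linarith
      then show "norm ((d j x)\<^sup>2) \<le> 4"
        using power_mono[of "\<bar>d j x\<bar>" 2 2] by simp
    qed
  qed measurable
  \<comment> \<open>The weighted squares have a finite integral, so their series converges almost
    everywhere; the weights are what turns this into summability of \<open>d j x\<close>
    itself.\<close>
  have "(\<integral>\<^sup>+x. (\<Sum>j. ennreal (2^j * (d j x)\<^sup>2)) \<partial>M) = (\<Sum>j. \<integral>\<^sup>+x. ennreal (2^j * (d j x)\<^sup>2) \<partial>M)"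
    by (rule nn_integral_suminf) measurable
  also have "\<dots> \<le> (\<Sum>j. ennreal ((1/2)^j))"
  proof (rule suminf_le)
    fix j
    have "(\<integral>\<^sup>+x. ennreal (2^j * (d j x)\<^sup>2) \<partial>M) = ennreal (2^j * q (d j))"
      using d_int[of j] by (subst nn_integral_eq_integral) (auto simp: q_def)
    also have "\<dots> \<le> ennreal (2^j * (1/4)^j)"
      using qd by (intro ennreal_leI mult_left_mono) auto
    also have "2^j * (1/4)^j = ((1/2)^j :: real)"
      by (simp add: power_mult_distrib[symmetric])
    finally show "(\<integral>\<^sup>+x. ennreal (2^j * (d j x)\<^sup>2) \<partial>M) \<le> ennreal ((1/2)^j)" .
  qed auto
  also have "\<dots> < \<infinity>"
    by (subst suminf_ennreal2) (auto intro: summable_geometric)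
  finally have "AE x in M. (\<Sum>j. ennreal (2^j * (d j x)\<^sup>2)) \<noteq> \<infinity>"
    by (intro nn_integral_noteq_infinite) auto
  then have "AE x in M. convergent (\<lambda>j. u (r j) x)"
  proof eventually_elim
    case (elim x)
    then have "summable (\<lambda>j. 2^j * (d j x)\<^sup>2)"
      by (intro summable_suminf_not_top) auto
    then have "summable (\<lambda>j. 2^j * (d j x)\<^sup>2 + (1/2)^j)"
      by (intro summable_add summable_geometric) auto
    then have "summable (\<lambda>j. d j x)"
    proof (rule summable_comparison_test')
      fix j
      \<comment> \<open>Either the increment is at most (1/2)^j, or 1 \<le> 2^j |d j x|, and
        multiplying by |d j x| bounds it by the square term.\<close>
      show "norm (d j x) \<le> 2^j * (d j x)\<^sup>2 + (1/2)^j"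
      proof (cases "\<bar>d j x\<bar> \<le> (1/2)^j")
        case False
        then have "1 \<le> 2^j * \<bar>d j x\<bar>"
          by (simp add: field_simps)
        from mult_right_mono[OF this, of "\<bar>d j x\<bar>"]
        show ?thesis by (auto simp: power2_eq_square mult.assoc add_increasing2)
      qed (auto simp: add_increasing)
    qed
    then have "convergent (\<lambda>n. u (r 0) x - (\<Sum>j<n. d j x))"
      by (intro convergent_diff) (auto simp: summable_iff_convergent convergent_const)
    moreover have "u (r 0) x - (\<Sum>j<n. d j x) = u (r n) x" for n
      by (induction n) (auto simp: d_def)
    ultimately show ?case by simp
  qed
  moreover have "u (r j) \<in> C j" for j
    using u(1) C_mono[OF r_ge(2)] by blast
  ultimately show thesis by (intro that[of "\<lambda>j. u (r j)"])
qed

section \<open>Convexity and lower semicontinuity of the energy\<close>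

lemma liminf_add_ge_ennreal:
  fixes f g :: "nat \<Rightarrow> ennreal"
  shows "liminf f + liminf g \<le> liminf (\<lambda>n. f n + g n)"
proof -
  have "liminf f + liminf g = (SUP n. (INF m\<in>{n..}. f m) + (INF m\<in>{n..}. g m))"
    unfolding liminf_SUP_INF
    by (intro ennreal_SUP_add[symmetric] monoI INF_superset_mono) auto
  also have "\<dots> \<le> liminf (\<lambda>n. f n + g n)"
    unfolding liminf_SUP_INF by (intro SUP_mono' INF_greatest add_mono INF_lower)
  finally show ?thesis .
qed

text \<open>
  No positive parts are needed: \<^const>\<open>ennreal\<close> maps negative reals to \<open>0\<close>.
\<close>
definition cut_energy ::
    "'a measure \<Rightarrow> ('a \<Rightarrow> 'a \<Rightarrow> real) \<Rightarrow> ('a \<Rightarrow> real) \<Rightarrow> ('a \<Rightarrow> real) \<Rightarrow> ('a \<Rightarrow> real) \<Rightarrow> ennreal" where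
  "cut_energy M k a b u =
     (\<integral>\<^sup>+x. \<integral>\<^sup>+y. ennreal (k x y) * ennreal (u x - u y) \<partial>M \<partial>M) +
     (\<integral>\<^sup>+x. ennreal (a x) * ennreal (u x) + ennreal (b x) * ennreal (1 - u x) \<partial>M)"

text \<open>Subadditivity of the positive part, with truncation by \<open>ennreal\<close> in the
  role of the positive part. Convexity of the energy is this inequality integrated.\<close>

lemma ennreal_midpoint_diff_le:
  "2 * ennreal ((p + q) / 2 - (p' + q') / 2) \<le> ennreal (p - p') + ennreal (q - q')"
proof -
  have "2 * ennreal ((p + q) / 2 - (p' + q') / 2) = ennreal ((p - p') + (q - q'))"
  proof -
    have "(p - p') + (q - q') = 2 * ((p + q) / 2 - (p' + q') / 2)"
      by (simp add: field_simps)
    then show ?thesis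
      by (simp only: ennreal_mult' ennreal_numeral zero_le_numeral)
  qed
  also have "\<dots> \<le> ennreal (max 0 (p - p') + max 0 (q - q'))"
    by (intro ennreal_leI) simp
  also have "\<dots> = ennreal (p - p') + ennreal (q - q')"
    by (subst ennreal_plus) (auto simp: max_def ennreal_neg)
  finally show ?thesis .
qed

context sigma_finite_measure
begin

lemma cut_energy_midpoint:
  assumes [measurable]: "case_prod k \<in> borel_measurable (M \<Otimes>\<^sub>M M)"
      "a \<in> borel_measurable M" "b \<in> borel_measurable M"
      "u \<in> borel_measurable M" "v \<in> borel_measurable M"
  shows "2 * cut_energy M k a b (\<lambda>x. (u x + v x) / 2) \<le> cut_energy M k a b u + cut_energy M k a b v"
proof -
  let ?w = "\<lambda>x. (u x + v x) / 2"
  have k_section [measurable]: "k x \<in> borel_measurable M" if "x \<in> space M" for x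
    using measurable_Pair2[OF assms(1) that] by simp
  have "2 * (\<integral>\<^sup>+x. \<integral>\<^sup>+y. ennreal (k x y) * ennreal (?w x - ?w y) \<partial>M \<partial>M)
      = (\<integral>\<^sup>+x. 2 * (\<integral>\<^sup>+y. ennreal (k x y) * ennreal (?w x - ?w y) \<partial>M) \<partial>M)"
    by (rule nn_integral_cmult[symmetric]) measurable
  also have "\<dots> = (\<integral>\<^sup>+x. \<integral>\<^sup>+y. ennreal (k x y) * (2 * ennreal (?w x - ?w y)) \<partial>M \<partial>M)"
    by (intro nn_integral_cong) (simp add: nn_integral_cmult[symmetric] mult.left_commute)
  also have "\<dots> \<le> (\<integral>\<^sup>+x. \<integral>\<^sup>+y. ennreal (k x y) * (ennreal (u x - u y) + ennreal (v x - v y)) \<partial>M \<partial>M)"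
    by (intro nn_integral_mono mult_left_mono ennreal_midpoint_diff_le) auto
  also have "\<dots> = (\<integral>\<^sup>+x. \<integral>\<^sup>+y. ennreal (k x y) * ennreal (u x - u y) \<partial>M \<partial>M)
      + (\<integral>\<^sup>+x. \<integral>\<^sup>+y. ennreal (k x y) * ennreal (v x - v y) \<partial>M \<partial>M)"
    unfolding distrib_left
    by (subst nn_integral_add[symmetric]) (auto intro!: nn_integral_cong nn_integral_add)
  finally have 1: "2 * (\<integral>\<^sup>+x. \<integral>\<^sup>+y. ennreal (k x y) * ennreal (?w x - ?w y) \<partial>M \<partial>M) \<le> \<dots>" .
  have "2 * (\<integral>\<^sup>+x. ennreal (a x) * ennreal (?w x) + ennreal (b x) * ennreal (1 - ?w x) \<partial>M)
      = (\<integral>\<^sup>+x. ennreal (a x) * (2 * ennreal (?w x)) + ennreal (b x) * (2 * ennreal (1 - ?w x)) \<partial>M)"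
    by (subst nn_integral_cmult[symmetric]) (auto simp: distrib_left mult.left_commute intro!: nn_integral_cong)
  also have "\<dots> \<le> (\<integral>\<^sup>+x. ennreal (a x) * (ennreal (u x) + ennreal (v x))
      + ennreal (b x) * (ennreal (1 - u x) + ennreal (1 - v x)) \<partial>M)"
  proof (intro nn_integral_mono add_mono mult_left_mono)
    fix x
    \<comment> \<open>Both linear terms are instances of the same inequality: first p' = q' = 0,
      then p = q = 1.\<close>
    show "2 * ennreal (?w x) \<le> ennreal (u x) + ennreal (v x)"
      using ennreal_midpoint_diff_le[of "u x" "v x" 0 0] by simp
    show "2 * ennreal (1 - ?w x) \<le> ennreal (1 - u x) + ennreal (1 - v x)"
      using ennreal_midpoint_diff_le[of 1 1 "u x" "v x"] by simp
  qed auto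
  also have "\<dots> = (\<integral>\<^sup>+x. ennreal (a x) * ennreal (u x) + ennreal (b x) * ennreal (1 - u x) \<partial>M)
      + (\<integral>\<^sup>+x. ennreal (a x) * ennreal (v x) + ennreal (b x) * ennreal (1 - v x) \<partial>M)"
    by (subst nn_integral_add[symmetric]) (auto simp: distrib_left add_ac intro!: nn_integral_cong)
  finally have "2 * (\<integral>\<^sup>+x. ennreal (a x) * ennreal (?w x) + ennreal (b x) * ennreal (1 - ?w x) \<partial>M) \<le> \<dots>" .
  from add_mono[OF 1 this] show ?thesis
    unfolding cut_energy_def by (simp only: distrib_left add_ac)
qed

text \<open>Fatou in y for almost every fixed x, then Fatou in x. The integrands converge because
  truncation is continuous and the factor \<open>ennreal (k x y)\<close> is finite.\<close>

lemma cut_energy_le_liminf: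
  assumes [measurable]: "case_prod k \<in> borel_measurable (M \<Otimes>\<^sub>M M)"
      "a \<in> borel_measurable M" "b \<in> borel_measurable M"
      "\<And>n. g n \<in> borel_measurable M"
    and lim: "AE x in M. (\<lambda>n. g n x) \<longlonglongrightarrow> u x"
  shows "cut_energy M k a b u \<le> liminf (\<lambda>n. cut_energy M k a b (g n))"
proof -
  have "(\<integral>\<^sup>+x. \<integral>\<^sup>+y. ennreal (k x y) * ennreal (u x - u y) \<partial>M \<partial>M)
      \<le> (\<integral>\<^sup>+x. liminf (\<lambda>n. \<integral>\<^sup>+y. ennreal (k x y) * ennreal (g n x - g n y) \<partial>M) \<partial>M)"
  proof (rule nn_integral_mono_AE)
    show "AE x in M. (\<integral>\<^sup>+y. ennreal (k x y) * ennreal (u x - u y) \<partial>M)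
        \<le> liminf (\<lambda>n. \<integral>\<^sup>+y. ennreal (k x y) * ennreal (g n x - g n y) \<partial>M)"
      using lim AE_space
    proof eventually_elim
      case (elim x)
      have [measurable]: "k x \<in> borel_measurable M"
        using measurable_Pair2[OF assms(1) elim(2)] by simp
      have "(\<integral>\<^sup>+y. ennreal (k x y) * ennreal (u x - u y) \<partial>M)
          = (\<integral>\<^sup>+y. liminf (\<lambda>n. ennreal (k x y) * ennreal (g n x - g n y)) \<partial>M)"
      proof (rule nn_integral_cong_AE)
        show "AE y in M. ennreal (k x y) * ennreal (u x - u y)
            = liminf (\<lambda>n. ennreal (k x y) * ennreal (g n x - g n y))"
          using lim
        proof eventually_elim
          case (elim y)
          then show ?case using \<open>(\<lambda>n. g n x) \<longlonglongrightarrow> u x\<close>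
            by (intro lim_imp_Liminf[symmetric] ennreal_tendsto_cmult tendsto_ennrealI tendsto_diff) auto
        qed
      qed
      also have "\<dots> \<le> liminf (\<lambda>n. \<integral>\<^sup>+y. ennreal (k x y) * ennreal (g n x - g n y) \<partial>M)"
        by (rule nn_integral_liminf) measurable
      finally show ?case .
    qed
  qed
  also have "\<dots> \<le> liminf (\<lambda>n. \<integral>\<^sup>+x. \<integral>\<^sup>+y. ennreal (k x y) * ennreal (g n x - g n y) \<partial>M \<partial>M)"
    by (rule nn_integral_liminf) measurable
  finally have 1: "(\<integral>\<^sup>+x. \<integral>\<^sup>+y. ennreal (k x y) * ennreal (u x - u y) \<partial>M \<partial>M) \<le> \<dots>" .
  have "(\<integral>\<^sup>+x. ennreal (a x) * ennreal (u x) + ennreal (b x) * ennreal (1 - u x) \<partial>M)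
      = (\<integral>\<^sup>+x. liminf (\<lambda>n. ennreal (a x) * ennreal (g n x) + ennreal (b x) * ennreal (1 - g n x)) \<partial>M)"
  proof (rule nn_integral_cong_AE)
    show "AE x in M. ennreal (a x) * ennreal (u x) + ennreal (b x) * ennreal (1 - u x)
        = liminf (\<lambda>n. ennreal (a x) * ennreal (g n x) + ennreal (b x) * ennreal (1 - g n x))"
      using lim
      by eventually_elim
         (intro lim_imp_Liminf[symmetric] tendsto_add ennreal_tendsto_cmult tendsto_ennrealI
            tendsto_diff tendsto_const; simp)
  qed
  also have "\<dots> \<le> liminf (\<lambda>n. \<integral>\<^sup>+x. ennreal (a x) * ennreal (g n x) + ennreal (b x) * ennreal (1 - g n x) \<partial>M)"
    by (rule nn_integral_liminf) measurable
  finally have "(\<integral>\<^sup>+x. ennreal (a x) * ennreal (u x) + ennreal (b x) * ennreal (1 - u x) \<partial>M) \<le> \<dots>" .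
  from add_mono[OF 1 this] show ?thesis
    unfolding cut_energy_def using liminf_add_ge_ennreal order_trans by blast
qed

section \<open>Superlevel sets and the coarea inequality\<close>

lemma cut_energy_cong:
  "(\<And>x. x \<in> space M \<Longrightarrow> u x = v x) \<Longrightarrow> cut_energy M k a b u = cut_energy M k a b v"
  unfolding cut_energy_def by (simp cong: nn_integral_cong)

text \<open>For t uniform in (0, 1), Tonelli bounds the mean energy of the superlevel sets by the
  energy of u, hence by m. None of these energies is below the finite number m, so almost every one
  equals m.\<close>

lemma cut_energy_superlevel_exists:
  assumes [measurable]: "case_prod k \<in> borel_measurable (M \<Otimes>\<^sub>M M)"
      "a \<in> borel_measurable M" "b \<in> borel_measurable M" "u \<in> borel_measurable M"
    and le: "cut_energy M k a b u \<le> m" and fin: "m < \<infinity>"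
    and ge: "\<And>t. 0 < t \<Longrightarrow> t < 1 \<Longrightarrow> m \<le> cut_energy M k a b (indicator {x\<in>space M. t < u x})"
  obtains t where "0 < t" "t < 1" "cut_energy M k a b (indicator {x\<in>space M. t < u x}) \<le> m"
proof -
  define N where "N = density lborel (indicator {0<..<1::real})"
  \<comment> \<open>On the space this is the indicator of the superlevel set; as a function of two
    variables it is jointly measurable, which the exchange of integrals requires.\<close>
  define \<phi> where "\<phi> t x = (if t < u x then 1 else 0 :: real)" for t x
  define G where "G t = cut_energy M k a b (\<phi> t)" for t
  have G_eq: "G t = cut_energy M k a b (indicator {x\<in>space M. t < u x})" for t
    unfolding G_def by (rule cut_energy_cong) (simp add: \<phi>_def)
  have [measurable_cong]: "sets N = sets borel"
    by (simp add: N_def)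
  have N1: "emeasure N (space N) = 1"
    by (simp add: N_def emeasure_density)
  interpret N: finite_measure N
    by standard (simp add: N1)
  interpret MN: pair_sigma_finite M N
    by standard
  have [measurable]: "(\<lambda>z. \<phi> (f z) (g z)) \<in> borel_measurable L"
    if [measurable]: "f \<in> borel_measurable L" "g \<in> measurable L M" for f g and L :: "'d measure"
    unfolding \<phi>_def by measurable
  \<comment> \<open>Covers all three uses: the positive part of
    \<open>\<phi> t x - \<phi> t y\<close> is 1 only for t in [u y, u x), \<open>\<phi> t x\<close>
    only in [0, u x), and \<open>1 - \<phi> t x\<close> only in [u x, 1). If q < p, both sides are
    0.\<close>
  have N_le: "(\<integral>\<^sup>+t. f t \<partial>N) \<le> ennreal (q - p)"
    if [measurable]: "f \<in> borel_measurable borel" and f: "\<And>t. 0 < t \<Longrightarrow> t < 1 \<Longrightarrow> f t \<le> indicator {p..<q} t" for f p q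
  proof -
    have "(\<integral>\<^sup>+t. f t \<partial>N) = (\<integral>\<^sup>+t. indicator {0<..<1} t * f t \<partial>lborel)"
      unfolding N_def by (rule nn_integral_density) auto
    also have "\<dots> \<le> (\<integral>\<^sup>+t. indicator {p..<q} t \<partial>lborel)"
    proof (rule nn_integral_mono)
      show "indicator {0<..<1} t * f t \<le> indicator {p..<q} t" for t
        using f[of t] by (cases "t \<in> {0<..<1}") auto
    qed
    also have "\<dots> = ennreal (q - p)"
      by (cases "p \<le> q") (auto simp: ennreal_neg)
    finally show ?thesis .
  qed
  have "(\<integral>\<^sup>+t. \<integral>\<^sup>+x. \<integral>\<^sup>+y. ennreal (k x y) * ennreal (\<phi> t x - \<phi> t y) \<partial>M \<partial>M \<partial>N)
      = (\<integral>\<^sup>+x. \<integral>\<^sup>+t. \<integral>\<^sup>+y. ennreal (k x y) * ennreal (\<phi> t x - \<phi> t y) \<partial>M \<partial>N \<partial>M)"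
    by (rule MN.Fubini') measurable
  also have "\<dots> \<le> (\<integral>\<^sup>+x. \<integral>\<^sup>+y. ennreal (k x y) * ennreal (u x - u y) \<partial>M \<partial>M)"
  proof (rule nn_integral_mono)
    fix x assume x [simp]: "x \<in> space M"
    have [measurable]: "k x \<in> borel_measurable M"
      using measurable_Pair2[OF assms(1) x] by simp
    have "(\<integral>\<^sup>+t. \<integral>\<^sup>+y. ennreal (k x y) * ennreal (\<phi> t x - \<phi> t y) \<partial>M \<partial>N)
        = (\<integral>\<^sup>+y. \<integral>\<^sup>+t. ennreal (k x y) * ennreal (\<phi> t x - \<phi> t y) \<partial>N \<partial>M)"
      by (rule MN.Fubini') measurable
    also have "\<dots> = (\<integral>\<^sup>+y. ennreal (k x y) * (\<integral>\<^sup>+t. ennreal (\<phi> t x - \<phi> t y) \<partial>N) \<partial>M)"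
      by (intro nn_integral_cong nn_integral_cmult) measurable
    also have "\<dots> \<le> (\<integral>\<^sup>+y. ennreal (k x y) * ennreal (u x - u y) \<partial>M)"
      by (intro nn_integral_mono mult_left_mono N_le) (auto simp: \<phi>_def indicator_def ennreal_neg)
    finally show "(\<integral>\<^sup>+t. \<integral>\<^sup>+y. ennreal (k x y) * ennreal (\<phi> t x - \<phi> t y) \<partial>M \<partial>N) \<le> \<dots>" .
  qed
  finally have 1: "(\<integral>\<^sup>+t. \<integral>\<^sup>+x. \<integral>\<^sup>+y. ennreal (k x y) * ennreal (\<phi> t x - \<phi> t y) \<partial>M \<partial>M \<partial>N) \<le> \<dots>" .
  have "(\<integral>\<^sup>+t. \<integral>\<^sup>+x. ennreal (a x) * ennreal (\<phi> t x) + ennreal (b x) * ennreal (1 - \<phi> t x) \<partial>M \<partial>N)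
      = (\<integral>\<^sup>+x. \<integral>\<^sup>+t. ennreal (a x) * ennreal (\<phi> t x) + ennreal (b x) * ennreal (1 - \<phi> t x) \<partial>N \<partial>M)"
    by (rule MN.Fubini') measurable
  also have "\<dots> = (\<integral>\<^sup>+x. ennreal (a x) * (\<integral>\<^sup>+t. ennreal (\<phi> t x) \<partial>N)
      + ennreal (b x) * (\<integral>\<^sup>+t. ennreal (1 - \<phi> t x) \<partial>N) \<partial>M)"
  proof (rule nn_integral_cong)
    fix x assume [simp]: "x \<in> space M"
    show "(\<integral>\<^sup>+t. ennreal (a x) * ennreal (\<phi> t x) + ennreal (b x) * ennreal (1 - \<phi> t x) \<partial>N)
        = ennreal (a x) * (\<integral>\<^sup>+t. ennreal (\<phi> t x) \<partial>N) + ennreal (b x) * (\<integral>\<^sup>+t. ennreal (1 - \<phi> t x) \<partial>N)"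
      by (simp add: nn_integral_add nn_integral_cmult)
  qed
  also have "\<dots> \<le> (\<integral>\<^sup>+x. ennreal (a x) * ennreal (u x) + ennreal (b x) * ennreal (1 - u x) \<partial>M)"
  proof (intro nn_integral_mono add_mono mult_left_mono)
    fix x assume [simp]: "x \<in> space M"
    show "(\<integral>\<^sup>+t. ennreal (\<phi> t x) \<partial>N) \<le> ennreal (u x)"
      using N_le[of "\<lambda>t. ennreal (\<phi> t x)" 0 "u x"] by (auto simp: \<phi>_def indicator_def)
    show "(\<integral>\<^sup>+t. ennreal (1 - \<phi> t x) \<partial>N) \<le> ennreal (1 - u x)"
      by (rule N_le) (auto simp: \<phi>_def indicator_def)
  qed auto
  finally have "(\<integral>\<^sup>+t. \<integral>\<^sup>+x. ennreal (a x) * ennreal (\<phi> t x) + ennreal (b x) * ennreal (1 - \<phi> t x) \<partial>M \<partial>N) \<le> \<dots>" .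
  from add_mono[OF 1 this] have "(\<integral>\<^sup>+t. G t \<partial>N) \<le> cut_energy M k a b u"
    unfolding cut_energy_def G_def by (subst nn_integral_add) measurable
  with le have G_le: "(\<integral>\<^sup>+t. G t \<partial>N) \<le> m"
    by simp
  have [measurable]: "G \<in> borel_measurable N"
    unfolding G_def cut_energy_def by measurable
  have N_AE: "AE t in N. 0 < t \<and> t < 1"
    unfolding N_def by (subst AE_density) (auto simp: indicator_def)
  \<comment> \<open>Subtraction in \<open>ennreal\<close> is truncated; it commutes with the
    integral because m is finite and m \<le> G t almost everywhere.\<close>
  have "(\<integral>\<^sup>+t. G t - m \<partial>N) = (\<integral>\<^sup>+t. G t \<partial>N) - (\<integral>\<^sup>+t. m \<partial>N)"
  proof (rule nn_integral_diff)
    show "AE t in N. m \<le> G t"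
      using N_AE by eventually_elim (simp add: G_eq ge)
  qed (use fin in \<open>auto simp: N1\<close>)
  also have "\<dots> = 0"
    using G_le fin by (simp add: N1 diff_eq_0_iff_ennreal)
  finally have "AE t in N. G t - m = 0"
    by (subst (asm) nn_integral_0_iff_AE) auto
  with N_AE have "AE t in N. 0 < t \<and> t < 1 \<and> G t \<le> m"
    by eventually_elim (use fin in \<open>auto simp: diff_eq_0_iff_ennreal\<close>)
  moreover have "ae_filter N \<noteq> bot"
    by (simp add: ae_filter_eq_bot_iff N1)
  ultimately obtain t where "0 < t \<and> t < 1 \<and> G t \<le> m"
    using eventually_happens' by blast
  then show thesis
    using that[of t] by (simp add: G_eq)
qed

section \<open>Existence of a set of minimal energy with prescribed exterior\<close>

lemma cut_energy_minimizer_exists: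
  assumes [measurable]: "case_prod k \<in> borel_measurable (M \<Otimes>\<^sub>M M)"
      "a \<in> borel_measurable M" "b \<in> borel_measurable M"
    and \<Omega> [measurable]: "\<Omega> \<in> sets M" and \<Omega>_fin: "emeasure M \<Omega> < \<infinity>"
    and A [measurable]: "A \<in> sets M"
  obtains E where "E \<in> sets M" "E - \<Omega> = A - \<Omega>"
    "\<And>F. F \<in> sets M \<Longrightarrow> F - \<Omega> = A - \<Omega> \<Longrightarrow>
      cut_energy M k a b (indicator E) \<le> cut_energy M k a b (indicator F)"
proof -
  define \<A> where "\<A> = {F\<in>sets M. F - \<Omega> = A - \<Omega>}"
  define m where "m = (INF F\<in>\<A>. cut_energy M k a b (indicator F))"
  have m_le: "m \<le> cut_energy M k a b (indicator F)" if "F \<in> \<A>" for F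
    unfolding m_def using that by (rule INF_lower)
  have "\<exists>E\<in>\<A>. cut_energy M k a b (indicator E) \<le> m"
  \<comment> \<open>If the infimum is infinite, any admissible set attains it, for instance
    A.\<close>
  proof (cases "m = \<infinity>")
    case True
    have "A \<in> \<A>" by (simp add: \<A>_def)
    then show ?thesis using True by (intro bexI[of _ A]) auto
  next
    case False
    \<comment> \<open>Sublevel sets of the relaxed energy. The level refers to the infimum m over
      sets, so indicators of near-minimal sets show that \<open>C n\<close> is nonempty.\<close>
    define C where "C n = {u \<in> borel_measurable M. (\<forall>x. 0 \<le> u x \<and> u x \<le> 1) \<and>
      (\<forall>x\<in>space M - \<Omega>. u x = indicator A x) \<and> cut_energy M k a b u \<le> m + ennreal (1 / Suc n)}" for n :: nat
    \<comment> \<open>The restriction of M to \<Omega>, a finite measure. Convergence has to be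
      arranged only there, since off \<Omega> all members of \<open>C n\<close> agree.\<close>
    define N where "N = density M (indicator \<Omega>)"
    have [measurable_cong]: "sets N = sets M"
      by (simp add: N_def)
    interpret N: finite_measure N
      using \<Omega>_fin sets.sets_into_space[OF \<Omega>]
      by (intro finite_measureI) (simp add: N_def emeasure_density Int_absorb1 less_top nn_integral_indicator)
    have C_meas: "u \<in> borel_measurable M" if "u \<in> C n" for u n
      using that by (simp add: C_def)
    obtain g where g: "\<And>n. g n \<in> C n" and conv: "AE x in N. convergent (\<lambda>n. g n x)"
    proof (rule N.midpoint_convex_AE_convergent[of C, OF _ _ _ _ _ that])
      show "u \<in> borel_measurable N" if "u \<in> C n" for u n
        using C_meas[OF that] by simp
      show "\<bar>u x\<bar> \<le> 1" if "u \<in> C n" for u n x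
        using that by (simp add: C_def)
      show "C n \<noteq> {}" for n
      proof -
        have "m < m + ennreal (1 / Suc n)"
          using False by (simp add: ennreal_lessI)
        then obtain F where "F \<in> \<A>" "cut_energy M k a b (indicator F) < m + ennreal (1 / Suc n)"
          unfolding m_def INF_less_iff by blast
        then have "indicator F \<in> C n"
          by (auto simp: C_def \<A>_def indicator_def)
        then show ?thesis by blast
      qed
      show "decseq C"
      proof (rule decseq_SucI)
        fix n
        have "ennreal (1 / Suc (Suc n)) \<le> ennreal (1 / Suc n)"
          by (intro ennreal_leI) (simp add: field_simps)
        then show "C (Suc n) \<le> C n"
          unfolding C_def by (auto intro: order_trans add_left_mono)
      qed
      show "(\<lambda>x. (u x + v x) / 2) \<in> C n" if u: "u \<in> C n" and v: "v \<in> C n" for u v n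
      proof -
        note [measurable] = C_meas[OF u] C_meas[OF v]
        have "2 * cut_energy M k a b (\<lambda>x. (u x + v x) / 2) \<le> cut_energy M k a b u + cut_energy M k a b v"
          by (rule cut_energy_midpoint) measurable
        also have "\<dots> \<le> 2 * (m + ennreal (1 / Suc n))"
          using u v unfolding mult_2 by (intro add_mono) (auto simp: C_def)
        finally have "cut_energy M k a b (\<lambda>x. (u x + v x) / 2) \<le> m + ennreal (1 / Suc n)"
          by (subst (asm) ennreal_mult_le_mult_iff) auto
        moreover have "0 \<le> u x + v x \<and> u x + v x \<le> 2" for x
        proof -
          have "0 \<le> u x" "u x \<le> 1" "0 \<le> v x" "v x \<le> 1"
            using u v by (auto simp: C_def)
          then show ?thesis by linarith
        qed
        ultimately show ?thesis
          using u v by (auto simp: C_def)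
      qed
    qed
    have [measurable]: "g n \<in> borel_measurable M" for n
      using g C_meas by blast
    \<comment> \<open>Where \<open>g n x\<close> diverges the value is unspecified; this happens
      only on a null set inside \<Omega>.\<close>
    define u where "u x = lim (\<lambda>n. g n x)" for x
    have [measurable]: "u \<in> borel_measurable M"
      unfolding u_def by measurable
    have outside: "g n x = indicator A x" if "x \<in> space M - \<Omega>" for n x
      using g[of n] that by (simp add: C_def)
    have "AE x in M. x \<in> \<Omega> \<longrightarrow> convergent (\<lambda>n. g n x)"
      using conv unfolding N_def by (subst (asm) AE_density) (auto simp: indicator_def)
    then have "AE x in M. (\<lambda>n. g n x) \<longlonglongrightarrow> u x"
      using AE_space
    proof eventually_elim
      case (elim x)
      then have "convergent (\<lambda>n. g n x)"
        using outside by (cases "x \<in> \<Omega>") (auto simp: convergent_const)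
      then show ?case
        by (simp add: u_def convergent_LIMSEQ_iff)
    qed
    then have "cut_energy M k a b u \<le> liminf (\<lambda>n. cut_energy M k a b (g n))"
      by (intro cut_energy_le_liminf) auto
    also have "\<dots> \<le> liminf (\<lambda>n. m + ennreal (1 / Suc n))"
      using g by (intro Liminf_mono always_eventually) (auto simp: C_def)
    also have "\<dots> = m"
    proof (intro lim_imp_Liminf)
      have "(\<lambda>n. m + ennreal (1 / Suc n)) \<longlonglongrightarrow> m + ennreal 0"
        by (intro tendsto_add tendsto_const tendsto_ennrealI LIMSEQ_Suc lim_1_over_n)
      then show "(\<lambda>n. m + ennreal (1 / Suc n)) \<longlonglongrightarrow> m" by simp
    qed simp
    finally have u_le: "cut_energy M k a b u \<le> m" .
    have superlevel: "{x\<in>space M. t < u x} \<in> \<A>" if "0 < t" "t < 1" for t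
    proof -
      \<comment> \<open>Off \<Omega> the sequence is constant, so the exterior condition holds at
        every point and not merely almost everywhere; for 0 < t < 1 the superlevel set of an
        indicator is the set itself.\<close>
      have "u x = indicator A x" if "x \<in> space M - \<Omega>" for x
        unfolding u_def using outside[OF that] by simp
      then have "{x\<in>space M. t < u x} - \<Omega> = A - \<Omega>"
        using that sets.sets_into_space[OF A] by (auto simp: indicator_def of_bool_def split: if_splits)
      then show ?thesis by (simp add: \<A>_def)
    qed
    obtain t where "0 < t" "t < 1" "cut_energy M k a b (indicator {x\<in>space M. t < u x}) \<le> m"
    proof (rule cut_energy_superlevel_exists[OF assms(1,2,3) _ u_le])
      show "m < \<infinity>" using False by (simp add: less_top)
    qed (use m_le superlevel in auto)
    then show ?thesis using superlevel by blast
  qed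
  then obtain E where "E \<in> \<A>" "cut_energy M k a b (indicator E) \<le> m"
    by blast
  then show thesis
    using m_le by (intro that[of E]) (auto simp: \<A>_def intro: order_trans)
qed

end

section \<open>The fractional perimeter as an interaction energy\<close>

lemma sigma_finite_lebesgue: "sigma_finite_measure (lebesgue :: 'a::euclidean_space measure)"
proof
  obtain \<A> :: "'a set set" where "countable \<A>" "\<A> \<subseteq> sets lborel" "\<Union>\<A> = space lborel"
      "\<forall>a\<in>\<A>. emeasure lborel a \<noteq> \<infinity>"
    using lborel.sigma_finite_countable by blast
  then show "\<exists>\<A>::'a set set. countable \<A> \<and> \<A> \<subseteq> sets lebesgue \<and> \<Union>\<A> = space lebesgue \<and>
      (\<forall>a\<in>\<A>. emeasure lebesgue a \<noteq> \<infinity>)"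
    by (intro exI[of _ \<A>]) (auto simp: subset_iff)
qed

interpretation lebesgue: sigma_finite_measure "lebesgue :: 'a::euclidean_space measure"
  by (rule sigma_finite_lebesgue)

text \<open>Removing the pairs with both points outside \<Omega> merges the two interaction terms of
  the perimeter into one double integral. On the diagonal the value is 1 / 0 = 0.\<close>

definition frac_kernel :: "real \<Rightarrow> (real ^ 'n) set \<Rightarrow> real ^ 'n \<Rightarrow> real ^ 'n \<Rightarrow> real" where
  "frac_kernel s \<Omega> x y =
     (if x \<in> \<Omega> \<or> y \<in> \<Omega> then 1 / norm (x - y) powr (real CARD('n) + s) else 0)"

lemma borel_measurable_frac_power [measurable]:
  "(\<lambda>(x, y). 1 / norm (x - y :: real ^ 'n) powr p) \<in> borel_measurable (lebesgue \<Otimes>\<^sub>M lebesgue)"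
proof -
  \<comment> \<open>The identity from the completed to the Borel sigma-algebra; composed with it,
    both projections of the product become Borel measurable.\<close>
  have [measurable]: "(\<lambda>x. x) \<in> borel_measurable (lebesgue :: (real ^ 'n) measure)"
    by (simp add: measurable_completion)
  have [measurable]: "fst \<in> borel_measurable (lebesgue \<Otimes>\<^sub>M lebesgue :: ((real ^ 'n) \<times> (real ^ 'n)) measure)"
      "snd \<in> borel_measurable (lebesgue \<Otimes>\<^sub>M lebesgue :: ((real ^ 'n) \<times> (real ^ 'n)) measure)"
    by (rule measurable_compose[of _ _ lebesgue "\<lambda>x. x"]; measurable)+
  show ?thesis
    unfolding case_prod_beta by measurable
qed

lemma borel_measurable_frac_kernel [measurable]:
  assumes [measurable]: "\<Omega> \<in> sets lebesgue"
  shows "case_prod (frac_kernel s \<Omega>) \<in> borel_measurable (lebesgue \<Otimes>\<^sub>M lebesgue)"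
  using borel_measurable_frac_power unfolding frac_kernel_def[abs_def] case_prod_beta by measurable

text \<open>The truncated difference of indicators selects x in F and y outside F. If x is in
  \<Omega>, the kernel admits every such y; otherwise only those in \<Omega>. These are the two
  terms of the perimeter.\<close>

lemma frac_perimeter_eq:
  fixes F \<Omega> :: "(real ^ 'n) set"
  assumes [measurable]: "F \<in> sets lebesgue" "\<Omega> \<in> sets lebesgue"
  shows "frac_perimeter s F \<Omega> =
    (\<integral>\<^sup>+x. \<integral>\<^sup>+y. ennreal (frac_kernel s \<Omega> x y) * ennreal (indicator F x - indicator F y) \<partial>lebesgue \<partial>lebesgue)"
proof -
  define K where "K x y = ennreal (1 / norm (x - y) powr (real CARD('n) + s))" for x y :: "real ^ 'n"
  have [measurable]: "case_prod K \<in> borel_measurable (lebesgue \<Otimes>\<^sub>M lebesgue)"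
    using borel_measurable_frac_power[of "real CARD('n) + s"] unfolding K_def case_prod_beta by measurable
  have "frac_perimeter s F \<Omega> =
      (\<integral>\<^sup>+x. (\<integral>\<^sup>+y. K x y * indicator (-F) y \<partial>lebesgue) * indicator (F \<inter> \<Omega>) x \<partial>lebesgue) +
      (\<integral>\<^sup>+x. (\<integral>\<^sup>+y. K x y * indicator (-F \<inter> \<Omega>) y \<partial>lebesgue) * indicator (F \<inter> -\<Omega>) x \<partial>lebesgue)"
    unfolding frac_perimeter_def frac_interaction_def K_def ..
  also have "\<dots> = (\<integral>\<^sup>+x. (\<integral>\<^sup>+y. K x y * indicator (-F) y \<partial>lebesgue) * indicator (F \<inter> \<Omega>) x +
      (\<integral>\<^sup>+y. K x y * indicator (-F \<inter> \<Omega>) y \<partial>lebesgue) * indicator (F \<inter> -\<Omega>) x \<partial>lebesgue)"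
    by (rule nn_integral_add[symmetric]) measurable
  also have "\<dots> = (\<integral>\<^sup>+x. \<integral>\<^sup>+y. ennreal (frac_kernel s \<Omega> x y) * ennreal (indicator F x - indicator F y) \<partial>lebesgue \<partial>lebesgue)"
  proof (rule nn_integral_cong)
    fix x :: "real ^ 'n"
    consider "x \<in> F" "x \<in> \<Omega>" | "x \<in> F" "x \<notin> \<Omega>" | "x \<notin> F" by blast
    then show "(\<integral>\<^sup>+y. K x y * indicator (-F) y \<partial>lebesgue) * indicator (F \<inter> \<Omega>) x +
      (\<integral>\<^sup>+y. K x y * indicator (-F \<inter> \<Omega>) y \<partial>lebesgue) * indicator (F \<inter> -\<Omega>) x =
      (\<integral>\<^sup>+y. ennreal (frac_kernel s \<Omega> x y) * ennreal (indicator F x - indicator F y) \<partial>lebesgue)"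
    proof cases
      case 1
      then show ?thesis
        by (auto simp: K_def frac_kernel_def indicator_def intro!: nn_integral_cong)
    next
      case 2
      then show ?thesis
        by (auto simp: K_def frac_kernel_def indicator_def intro!: nn_integral_cong)
    next
      case 3
      then show ?thesis
        by (simp add: ennreal_neg)
    qed
  qed
  finally show ?thesis .
qed

section \<open>From the energy to the Massari functional\<close>

text \<open>Pointwise, the linear part of the energy is 1_F h + h^-, whose integral is that of H
  over F \<inter> \<Omega> plus \<open>c\<close>. The shift by \<open>c\<close> makes it nonnegative
  and does not depend on F; as the integral is finite, only the perimeter can make the energy
  infinite.\<close>

lemma cut_energy_eq_massari:
  fixes s :: real and F \<Omega> :: "(real ^ 'n) set"
  assumes F [measurable]: "F \<in> sets lebesgue" and \<Omega> [measurable]: "\<Omega> \<in> sets lebesgue"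
    and H: "set_integrable lebesgue \<Omega> H"
  defines "h \<equiv> \<lambda>x. indicator \<Omega> x * H x"
  defines "c \<equiv> \<integral>x. max 0 (- h x) \<partial>lebesgue"
  defines "G \<equiv> cut_energy lebesgue (frac_kernel s \<Omega>) (\<lambda>x. max 0 (h x)) (\<lambda>x. max 0 (- h x)) (indicator F)"
  shows "enn2ereal G = massari s H \<Omega> F + ereal c"
    and "G < \<infinity> \<longleftrightarrow> frac_perimeter s F \<Omega> < \<infinity>"
proof -
  have h: "integrable lebesgue h"
    using H by (simp add: set_integrable_def h_def)
  have hF: "integrable lebesgue (\<lambda>x. indicator F x * h x)"
    using integrable_mult_indicator[OF F h] by simp
  have hc: "integrable lebesgue (\<lambda>x. max 0 (- h x))"
    using h by (intro integrable_max) auto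
  define R where "R = (\<integral>x. indicator F x * h x + max 0 (- h x) \<partial>lebesgue)"
  have nonneg: "0 \<le> indicator F x * h x + max 0 (- h x)" for x
    by (auto simp: indicator_def)
  have "(\<integral>\<^sup>+x. ennreal (max 0 (h x)) * ennreal (indicator F x) + ennreal (max 0 (- h x)) * ennreal (1 - indicator F x) \<partial>lebesgue)
      = (\<integral>\<^sup>+x. ennreal (indicator F x * h x + max 0 (- h x)) \<partial>lebesgue)"
    by (intro nn_integral_cong) (auto simp: indicator_def max_def)
  also have "\<dots> = ennreal R"
    unfolding R_def using hF hc nonneg by (intro nn_integral_eq_integral) auto
  finally have G: "G = frac_perimeter s F \<Omega> + ennreal R"
    unfolding G_def cut_energy_def frac_perimeter_eq[OF F \<Omega>] by simp
  have "0 \<le> R"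
    unfolding R_def using nonneg by simp
  moreover have "R = (LINT x:F \<inter> \<Omega>|lebesgue. H x) + c"
    unfolding R_def c_def using hF hc
    by (simp add: set_lebesgue_integral_def h_def indicator_inter_arith mult.assoc)
  ultimately show "enn2ereal G = massari s H \<Omega> F + ereal c"
    unfolding G massari_def by (simp add: plus_ennreal.rep_eq add.assoc)
  show "G < \<infinity> \<longleftrightarrow> frac_perimeter s F \<Omega> < \<infinity>"
    unfolding G by (simp add: less_top[symmetric])
qed

theorem theorem1p13:
  fixes s :: real and \<Omega> M :: "(real ^ 'n) set" and H :: "real ^ 'n \<Rightarrow> real"
  assumes "0 < s" and "s < 1"
    and "lipschitz_domain \<Omega>" and "bounded \<Omega>"
    and "set_integrable lebesgue \<Omega> H"
    and "M \<in> sets lebesgue" and "frac_perimeter s M \<Omega> < \<infinity>"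
  shows "\<exists>E \<in> competitors s \<Omega> M.
           massari s H \<Omega> E = (INF F \<in> competitors s \<Omega> M. massari s H \<Omega> F)"
proof -
  define h where "h x = indicator \<Omega> x * H x" for x
  define c where "c = (\<integral>x. max 0 (- h x) \<partial>lebesgue)"
  define G where "G F = cut_energy lebesgue (frac_kernel s \<Omega>) (\<lambda>x. max 0 (h x)) (\<lambda>x. max 0 (- h x)) (indicator F)" for F
  have "open \<Omega>"
    using assms(3) by (simp add: lipschitz_domain_def)
  then have \<Omega> [measurable]: "\<Omega> \<in> sets lebesgue"
    by (metis borel_open sets_completionI_sets sets_lborel)
  have "h \<in> borel_measurable lebesgue"
    using assms(5) by (auto simp: set_integrable_def h_def[abs_def] dest: borel_measurable_integrable)
  then have hm: "(\<lambda>x. max 0 (h x)) \<in> borel_measurable lebesgue"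
      "(\<lambda>x. max 0 (- h x)) \<in> borel_measurable lebesgue"
    by measurable
  have G: "enn2ereal (G F) = massari s H \<Omega> F + ereal c"
      "G F < \<infinity> \<longleftrightarrow> frac_perimeter s F \<Omega> < \<infinity>" if "F \<in> sets lebesgue" for F
    using cut_energy_eq_massari[OF that \<Omega> assms(5)] unfolding G_def h_def c_def by auto
  have "emeasure lebesgue \<Omega> < \<infinity>"
    using emeasure_bounded_finite[OF assms(4)] \<open>open \<Omega>\<close> by simp
  then obtain E where E: "E \<in> sets lebesgue" "E - \<Omega> = M - \<Omega>"
      and le: "\<And>F. F \<in> sets lebesgue \<Longrightarrow> F - \<Omega> = M - \<Omega> \<Longrightarrow> G E \<le> G F"
    using lebesgue.cut_energy_minimizer_exists[of "frac_kernel s \<Omega>" "\<lambda>x. max 0 (h x)" "\<lambda>x. max 0 (- h x)" \<Omega> M]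
      borel_measurable_frac_kernel[OF \<Omega>] assms(6) \<Omega>
    unfolding G_def by (metis (no_types, lifting) hm)
  \<comment> \<open>E is minimal among all measurable sets with the right exterior; comparison with
    M gives it finite perimeter, so it is a competitor.\<close>
  have "G E < \<infinity>"
    using le[of M] G(2)[of M] assms(6,7) by auto
  then have "E \<in> competitors s \<Omega> M"
    using E G(2) by (simp add: competitors_def)
  moreover have "massari s H \<Omega> E \<le> massari s H \<Omega> F" if "F \<in> competitors s \<Omega> M" for F
  proof -
    have F: "F \<in> sets lebesgue" "F - \<Omega> = M - \<Omega>"
      using that by (auto simp: competitors_def)
    have "massari s H \<Omega> E + ereal c \<le> massari s H \<Omega> F + ereal c"
      using le[OF F] unfolding G(1)[OF E(1), symmetric] G(1)[OF F(1), symmetric] less_eq_ennreal.rep_eq .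
    \<comment> \<open>The shift \<open>c\<close> is a real number, so it cancels in the extended
      reals.\<close>
    then show ?thesis
      by (cases "massari s H \<Omega> E"; cases "massari s H \<Omega> F") auto
  qed
  ultimately show ?thesis
    by (intro bexI[of _ E] antisym INF_greatest INF_lower) auto
qed

end
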